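(* For all nonnegative integers $n,k,m$, \[ \det\left(\sum_{s=0}^{2k+2m-1}\mu^{\le 2k+2m-1}_{n+i+j+2m-1,0,s}(\mathbf{0},\mathbf{1})\right)_{i,j=0}^{k-1} =(-1)^{\left(\binom{k}{2}+\binom{m}{2}\right)(n+1)}\det\left(\left|\mathrm{Alt}^{\le k+m}_{n+i+j}\right|\right)_{i,j=0}^{m-1}. \]
   Context: Let $\mathbf{b}=(b_i)_{i\ge0}$ and $\boldsymbol{\lambda}=(\lambda_i)_{i\ge1}$ be sequences. A Motzkin path is a finite sequence of points in $\mathbb{Z}\times\mathbb{Z}_{\ge0}$ whose steps (differences of consecutive points) are each $(1,1)$ (up), $(1,0)$ (horizontal) or $(1,-1)$ (down). Its weight $\mathrm{wt}(\pi;\mathbf{b},\boldsymbol{\lambda})$ is the product of $b_i$ over all horizontal steps starting at height ($y$-coordinate) $i$ and of $\lambda_i$ over all down steps starting at height $i$. For integers $0\le r,s\le K$ and $n\ge 0$, $\mu^{\le K}_{n,r,s}(\mathbf{b},\boldsymbol{\lambda})$ denotes the sum of the weights of all Motzkin paths from $(0,r)$ to $(n,s)$ all of whose points have $y$-coordinate at most $K$. Here $\mathbf{0}=(0,0,\dots)$ and $\mathbf{1}=(1,1,\dots)$. $\mathrm{Alt}^{\le K}_N$ is the set of sequences $(a_1,\dots,a_N)$ of integers with $a_1\le a_2\ge a_3\le a_4\ge\cdots$ and $1\le a_i\le K$ for all $i$ (for $N=0$ it consists of the empty sequence). The determinant of a $0\times 0$ matrix is $1$.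
   Formalization: For n = m = 0 and k ≥ 1 the entry i = j = 0 involves μ of length -1, which is not defined by paths; it is read as the value obtained by extending the sequence to negative lengths by its linear recurrence with constant coefficients and nonzero lowest coefficient. *)

theory Defs
  imports "Jordan_Normal_Form.Determinant"
begin

definition motzkin_step :: "int \<times> nat \<Rightarrow> int \<times> nat \<Rightarrow> bool" where
  "motzkin_step p q \<longleftrightarrow> fst q - fst p = 1 \<and> int (snd q) - int (snd p) \<in> {1, 0, -1}"

definition motzkin_path :: "(int \<times> nat) list \<Rightarrow> bool" where
  "motzkin_path ps \<longleftrightarrow>
     ps \<noteq> [] \<and> (\<forall>i. i + 1 < length ps \<longrightarrow> motzkin_step (ps ! i) (ps ! (i + 1)))"

definition step_weight ::
  "(nat \<Rightarrow> 'a::comm_semiring_1) \<Rightarrow> (nat \<Rightarrow> 'a) \<Rightarrow> int \<times> nat \<Rightarrow> int \<times> nat \<Rightarrow> 'a" where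
  "step_weight b l p q =
     (if snd q = snd p then b (snd p) else if snd q < snd p then l (snd p) else 1)"

text \<open>The second sequence is indexed from 1 in the mathematics; its value at 0 is never used,
  as no down step starts at height 0.\<close>

definition path_weight ::
  "(nat \<Rightarrow> 'a::comm_semiring_1) \<Rightarrow> (nat \<Rightarrow> 'a) \<Rightarrow> (int \<times> nat) list \<Rightarrow> 'a" where
  "path_weight b l ps = (\<Prod>i<length ps - 1. step_weight b l (ps ! i) (ps ! (i + 1)))"

definition bounded_paths :: "nat \<Rightarrow> nat \<Rightarrow> nat \<Rightarrow> nat \<Rightarrow> (int \<times> nat) list set" where
  "bounded_paths K n r s =
     {ps. motzkin_path ps \<and> hd ps = (0, r) \<and> last ps = (int n, s) \<and> (\<forall>p\<in>set ps. snd p \<le> K)}"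

definition bounded_moment ::
  "nat \<Rightarrow> (nat \<Rightarrow> 'a::comm_semiring_1) \<Rightarrow> (nat \<Rightarrow> 'a) \<Rightarrow> nat \<Rightarrow> nat \<Rightarrow> nat \<Rightarrow> 'a" where
  "bounded_moment K b l n r s = (\<Sum>ps\<in>bounded_paths K n r s. path_weight b l ps)"

text \<open>A sequence on the natural numbers that satisfies a homogeneous linear recurrence with
  constant coefficients whose lowest coefficient is nonzero extends uniquely to all integers by
  running the recurrence backwards; the extension does not depend on the recurrence chosen.\<close>

definition extends_by_recurrence :: "(nat \<Rightarrow> 'a::field) \<Rightarrow> (int \<Rightarrow> 'a) \<Rightarrow> bool" where
  "extends_by_recurrence f g \<longleftrightarrow>
     (\<forall>n. g (int n) = f n) \<and>
     (\<exists>d c. 0 < d \<and> c 0 \<noteq> 0 \<and> (\<forall>n. g (n + int d) = (\<Sum>i<d. c i * g (n + int i))))"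

text \<open>The moment with integer length index: the path sum for nonnegative lengths, and its
  extension by recurrence for negative ones. At negative lengths it is unspecified if no
  extension exists.\<close>

definition mu ::
  "nat \<Rightarrow> (nat \<Rightarrow> 'a::field) \<Rightarrow> (nat \<Rightarrow> 'a) \<Rightarrow> int \<Rightarrow> nat \<Rightarrow> nat \<Rightarrow> 'a" where
  "mu K b l n r s =
     (if 0 \<le> n then bounded_moment K b l (nat n) r s
      else (THE g. extends_by_recurrence (\<lambda>n. bounded_moment K b l n r s) g) n)"

text \<open>Lists are indexed from 0, so the entry at an even list index is at an odd position
  of the sequence.\<close>

definition alt_seqs :: "nat \<Rightarrow> nat \<Rightarrow> int list set" where
  "alt_seqs K N =
     {a. length a = N \<and> (\<forall>x\<in>set a. 1 \<le> x \<and> x \<le> int K) \<and>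
         (\<forall>i. i + 1 < N \<longrightarrow> (if even i then a ! i \<le> a ! (i + 1) else a ! i \<ge> a ! (i + 1)))}"

end

theory Submission
  imports Defs
begin

text \<open>
  Let \<open>N = k + m\<close>, let \<open>A\<close> be the adjacency matrix of the path with \<open>2N\<close> vertices and \<open>C\<close> that of
  the path with \<open>N\<close> vertices and a loop at the end vertex \<open>0\<close>. Folding the long path in the middle,
  together with the fact that \<open>C\<close> commutes with \<open>B = ([i + j < N])\<close>, turns the sum over \<open>s\<close> into the
  single entry \<open>(C^z)_{00}\<close>, also for negative \<open>z\<close>. As \<open>C\<close> is tridiagonal with off-diagonal entries
  \<open>1\<close>, the Hankel determinant of these entries is the leading minor of size \<open>k\<close> of \<open>C^p\<close> with
  \<open>p = n + 2m - 1\<close>. By Jacobi's identity this minor is \<open>det C^p\<close> times the complementary minor of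
  \<open>C^{-p}\<close>, which in the same way is a Hankel determinant of entries of negative powers of \<open>C\<close> at the
  other end vertex. Up to signs and a relabelling of the vertices \<open>C^{-1}\<close> is \<open>B\<close>, the transfer matrix
  of alternating sequences, so these entries are signed numbers of alternating sequences.
\<close>

section \<open>Integer powers of matrices\<close>

lemma mult_mat_entry:
  assumes "A \<in> carrier_mat n l" "B \<in> carrier_mat l q" "i < n" "j < q"
  shows "(A * B) $$ (i, j) = (\<Sum>a<l. A $$ (i, a) * B $$ (a, j))"
  using assms by (auto simp: scalar_prod_def lessThan_atLeast0 intro!: sum.cong)

lemma mult_mult_mat_entry:
  assumes "X \<in> carrier_mat n l" "P \<in> carrier_mat l q" "Y \<in> carrier_mat q r" "i < n" "j < r"
  shows "(X * P * Y) $$ (i, j) = (\<Sum>c<q. (\<Sum>a<l. X $$ (i, a) * P $$ (a, c)) * Y $$ (c, j))"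
proof -
  have "(X * P * Y) $$ (i, j) = (\<Sum>c<q. (X * P) $$ (i, c) * Y $$ (c, j))"
    using assms by (intro mult_mat_entry) auto
  also have "\<dots> = (\<Sum>c<q. (\<Sum>a<l. X $$ (i, a) * P $$ (a, c)) * Y $$ (c, j))"
    using assms(4) by (intro sum.cong refl) (simp add: mult_mat_entry[OF assms(1,2)] del: index_mult_mat(1))
  finally show ?thesis .
qed

lemma pow_mat_Suc_left:
  assumes "A \<in> carrier_mat n n"
  shows "A ^\<^sub>m Suc i = A * A ^\<^sub>m i"
proof (induction i)
  case 0
  then show ?case using assms by simp
next
  case (Suc i)
  have "A ^\<^sub>m Suc (Suc i) = (A * A ^\<^sub>m i) * A" using Suc by simp
  also have "\<dots> = A * A ^\<^sub>m Suc i" using assms by (simp add: assoc_mult_mat[of _ n n _ n _ n])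
  finally show ?case .
qed

lemma transpose_pow_mat:
  fixes A :: "'a::comm_ring_1 mat"
  assumes "A \<in> carrier_mat n n"
  shows "(A ^\<^sub>m i)\<^sup>T = A\<^sup>T ^\<^sub>m i"
proof (induction i)
  case (Suc i)
  then show ?case
    using assms pow_mat_Suc_left[of "A\<^sup>T" n i]
      transpose_mult[OF pow_carrier_mat[OF assms] assms, of i] by simp
qed (use assms in simp)

text \<open>The second argument stands for the inverse of the first.\<close>

definition zpow :: "'a::comm_ring_1 mat \<Rightarrow> 'a mat \<Rightarrow> int \<Rightarrow> 'a mat" where
  "zpow A A' z = (if 0 \<le> z then A ^\<^sub>m nat z else A' ^\<^sub>m nat (- z))"

locale inverse_pair =
  fixes d :: nat and A A' :: "'a::comm_ring_1 mat"
  assumes carrier: "A \<in> carrier_mat d d" "A' \<in> carrier_mat d d"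
    and right_inv: "A * A' = 1\<^sub>m d" and left_inv: "A' * A = 1\<^sub>m d"
begin

lemma zpow_carrier [simp]: "zpow A A' z \<in> carrier_mat d d"
  using carrier by (simp add: zpow_def)

lemma zpow_0 [simp]: "zpow A A' 0 = 1\<^sub>m d"
  using carrier by (simp add: zpow_def)

lemma zpow_of_nat [simp]: "zpow A A' (int n) = A ^\<^sub>m n"
  by (simp add: zpow_def)

lemma zpow_minus_of_nat: "zpow A A' (- int n) = A' ^\<^sub>m n"
  using carrier by (cases n) (simp_all add: zpow_def nat_add_distrib)

lemma zpow_plus_1: "zpow A A' (z + 1) = zpow A A' z * A"
proof (cases "0 \<le> z")
  case True
  then have "nat (z + 1) = Suc (nat z)" by simp
  with True show ?thesis by (simp add: zpow_def)
next
  case False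
  define k where "k = nat (- z - 1)"
  have z: "z = - int (Suc k)" using False by (simp add: k_def)
  have "zpow A A' z * A = A' ^\<^sub>m k * A' * A"
    unfolding z zpow_minus_of_nat by simp
  also have "\<dots> = A' ^\<^sub>m k"
    using carrier by (simp add: assoc_mult_mat[of _ d d _ d _ d] left_inv)
  finally show ?thesis using zpow_minus_of_nat[of k] z by simp
qed

lemma zpow_minus_1: "zpow A A' (z - 1) = zpow A A' z * A'"
proof -
  have "zpow A A' z * A' = zpow A A' (z - 1) * A * A'"
    using zpow_plus_1[of "z - 1"] by simp
  also have "\<dots> = zpow A A' (z - 1)"
    using carrier by (simp add: assoc_mult_mat[of _ d d _ d _ d] right_inv right_mult_one_mat[of _ d d])
  finally show ?thesis by simp
qed

lemma zpow_add: "zpow A A' (x + y) = zpow A A' x * zpow A A' y"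
proof (induction y rule: int_induct[where k = 0])
  case base
  then show ?case by (simp add: right_mult_one_mat[of _ d d])
next
  case (step1 y)
  then show ?case
    using zpow_plus_1[of "x + y"] carrier
    by (simp add: zpow_plus_1 assoc_mult_mat[of _ d d _ d _ d] flip: add.assoc)
next
  case (step2 y)
  then show ?case
    using zpow_minus_1[of "x + y"] carrier
    by (simp add: zpow_minus_1 assoc_mult_mat[of _ d d _ d _ d] flip: add_diff_eq)
qed

end

text \<open>The relation passes to the inverses,
  \<open>A' * F = A' * F * C * C' = A' * A * F * C' = F * C'\<close>, so the exponent can be moved
  by one in either direction. It is applied to a rectangular folding matrix \<open>F\<close> and to
  a square matrix commuting with \<open>A\<close>.\<close>

lemma zpow_intertwine:
  assumes "inverse_pair d A A'" "inverse_pair e C C'"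
    and F: "F \<in> carrier_mat d e" and AF: "A * F = F * C"
  shows "zpow A A' z * F = F * zpow C C' z"
proof -
  interpret A: inverse_pair d A A' by fact
  interpret C: inverse_pair e C C' by fact
  note [simp] = A.carrier C.carrier F
  have AF': "A' * F = F * C'"
  proof -
    have "A' * F = A' * (F * (C * C'))"
      using F by (simp add: C.right_inv right_mult_one_mat[of F d e])
    also have "\<dots> = A' * (A * F * C')"
      by (simp add: AF assoc_mult_mat[of _ d e _ e _ e])
    also have "\<dots> = (A' * A) * (F * C')"
      using assoc_mult_mat[of A' d d A d "F * C'" e] mult_carrier_mat[of F d e C' e]
      by (simp add: assoc_mult_mat[of _ d d _ e _ e])
    also have "\<dots> = F * C'" using mult_carrier_mat[of F d e C' e] by (simp add: A.left_inv left_mult_one_mat[of _ d e])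
    finally show ?thesis .
  qed
  show ?thesis
  proof (induction z rule: int_induct[where k = 0])
    case base
    then show ?case by (simp add: left_mult_one_mat[of _ d e] right_mult_one_mat[of _ d e])
  next
    case (step1 z)
    have "zpow A A' (z + 1) * F = zpow A A' z * F * C"
      by (simp add: A.zpow_plus_1 AF assoc_mult_mat[of _ d d _ d _ e] flip: assoc_mult_mat[of _ d d _ e _ e])
    with step1 show ?case
      by (simp add: C.zpow_plus_1 assoc_mult_mat[of _ d e _ e _ e])
  next
    case (step2 z)
    have "zpow A A' (z - 1) * F = zpow A A' z * F * C'"
      by (simp add: A.zpow_minus_1 AF' assoc_mult_mat[of _ d d _ d _ e] flip: assoc_mult_mat[of _ d d _ e _ e])
    with step2 show ?case
      by (simp add: C.zpow_minus_1 assoc_mult_mat[of _ d e _ e _ e])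
  qed
qed

lemma inverse_pair_exists:
  fixes A :: "'a::field mat"
  assumes A: "A \<in> carrier_mat d d" and "det A \<noteq> 0"
  shows "\<exists>A'. inverse_pair d A A'"
proof -
  have "A \<in> Units (ring_mat TYPE('a) d undefined)"
    using det_non_zero_imp_unit[OF assms] .
  then obtain A' where "A' \<in> carrier_mat d d" "A' * A = 1\<^sub>m d" "A * A' = 1\<^sub>m d"
    unfolding Units_def by (auto simp: ring_mat_def)
  with A show ?thesis by (auto simp: inverse_pair_def)
qed

section \<open>Reversal, sign changes and complementary minors\<close>

lemma det_pow_mat:
  assumes "A \<in> carrier_mat n n"
  shows "det (A ^\<^sub>m i) = det A ^ i"
proof (induction i)
  case (Suc i)
  then show ?case using assms by (simp add: det_mult[of _ n])
qed (use assms in simp)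

text \<open>For square \<open>X\<close> this is conjugation by the reversal permutation. It
  exchanges the two ends of a path, so that the last vertex becomes vertex 0.\<close>

definition rev_mat :: "'a mat \<Rightarrow> 'a mat" where
  "rev_mat X = mat (dim_row X) (dim_col X) (\<lambda>(i, j). X $$ (dim_row X - 1 - i, dim_col X - 1 - j))"

lemma rev_mat_carrier [simp]: "X \<in> carrier_mat n m \<Longrightarrow> rev_mat X \<in> carrier_mat n m"
  by (auto simp: rev_mat_def)

lemma rev_mat_mult:
  assumes "X \<in> carrier_mat n n" "Y \<in> carrier_mat n n"
  shows "rev_mat (X * Y) = rev_mat X * rev_mat Y"
proof (rule eq_matI)
  fix i j assume "i < dim_row (rev_mat X * rev_mat Y)" "j < dim_col (rev_mat X * rev_mat Y)"
  then have ij: "i < n" "j < n" using assms by (auto simp: rev_mat_def)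
  have "rev_mat (X * Y) $$ (i, j) = (\<Sum>a<n. X $$ (n - 1 - i, a) * Y $$ (a, n - 1 - j))"
    using assms ij by (simp add: rev_mat_def mult_mat_entry[of _ n n _ n] del: index_mult_mat(1))
  also have "\<dots> = (\<Sum>a<n. X $$ (n - 1 - i, n - 1 - a) * Y $$ (n - 1 - a, n - 1 - j))"
    by (subst sum.nat_diff_reindex[symmetric]) simp
  also have "\<dots> = (rev_mat X * rev_mat Y) $$ (i, j)"
    using assms ij
    by (subst mult_mat_entry[of _ n n _ n]) (auto simp: rev_mat_def)
  finally show "rev_mat (X * Y) $$ (i, j) = (rev_mat X * rev_mat Y) $$ (i, j)" .
qed (use assms in \<open>auto simp: rev_mat_def\<close>)

lemma rev_mat_one: "rev_mat (1\<^sub>m n) = 1\<^sub>m n"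
  by (rule eq_matI) (auto simp: rev_mat_def)

lemma rev_mat_pow:
  assumes "X \<in> carrier_mat n n"
  shows "rev_mat (X ^\<^sub>m i) = rev_mat X ^\<^sub>m i"
proof (induction i)
  case 0
  have "dim_row (rev_mat X) = n" using assms by (simp add: rev_mat_def)
  then show ?case using assms by (simp add: rev_mat_one)
next
  case (Suc i)
  then show ?case using assms by (simp add: rev_mat_mult[of _ n])
qed

text \<open>Rows and columns undergo the same permutation, so its sign enters squared. Transposing
  in between lets the rule for permuted rows serve for the columns too.\<close>

lemma det_rev_mat:
  assumes X: "X \<in> carrier_mat n n"
  shows "det (rev_mat X) = det X"
proof -
  define p where "p i = (if i < n then n - 1 - i else i)" for i
  have "bij_betw p {0..<n} {0..<n}"
    by (rule bij_betw_byWitness[of _ p]) (auto simp: p_def)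
  then have p: "p permutes {0..<n}"
    by (rule bij_imp_permutes) (auto simp: p_def)
  define Y where "Y = mat n n (\<lambda>(i, j). X $$ (p i, j))"
  have Y: "Y \<in> carrier_mat n n" by (simp add: Y_def)
  have "(rev_mat X)\<^sup>T = mat n n (\<lambda>(i, j). Y\<^sup>T $$ (p i, j))"
    using X by (auto simp: rev_mat_def Y_def p_def intro!: eq_matI)
  then have "det (rev_mat X)\<^sup>T = signof p * (signof p * det X)"
    using det_permute_rows[OF X p] det_permute_rows[of "Y\<^sup>T" n p] p det_transpose[OF Y]
    by (simp add: Y_def)
  then show ?thesis
    using det_transpose[of "rev_mat X" n] X by (simp add: sign_def split: if_splits)
qed

lemma det_reverse:
  "det (mat n n (\<lambda>(i, j). f (n - 1 - i) (n - 1 - j))) = det (mat n n (\<lambda>(i, j). f i j))"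
proof -
  have "mat n n (\<lambda>(i, j). f (n - 1 - i) (n - 1 - j)) = rev_mat (mat n n (\<lambda>(i, j). f i j))"
    by (rule eq_matI) (auto simp: rev_mat_def)
  then show ?thesis by (simp add: det_rev_mat[of _ n])
qed

text \<open>Replacing the first \<open>k\<close> columns of \<open>Q\<close> by unit columns gives
  the block triangular \<open>?R\<close>. Multiplication by \<open>P\<close> turns these columns
  into columns of \<open>P\<close> and the remaining ones into unit columns, because
  \<open>P * Q\<close> is the identity. The determinants of the two block triangular matrices then
  give the claim.\<close>

lemma jacobi_complementary_minor:
  fixes P Q :: "'a::idom mat"
  assumes P: "P \<in> carrier_mat (k + m) (k + m)" and Q: "Q \<in> carrier_mat (k + m) (k + m)"
    and PQ: "P * Q = 1\<^sub>m (k + m)"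
  shows "det (mat k k (\<lambda>(i, j). P $$ (i, j))) =
    det P * det (mat m m (\<lambda>(i, j). Q $$ (k + i, k + j)))"
proof -
  define Pk where "Pk = mat k k (\<lambda>(i, j). P $$ (i, j))"
  define Pm where "Pm = mat m k (\<lambda>(i, j). P $$ (k + i, j))"
  define Qm where "Qm = mat m m (\<lambda>(i, j). Q $$ (k + i, k + j))"
  define Qk where "Qk = mat k m (\<lambda>(i, j). Q $$ (i, k + j))"
  let ?R = "four_block_mat (1\<^sub>m k) Qk (0\<^sub>m m k) Qm"
  let ?S = "four_block_mat Pk (0\<^sub>m k m) Pm (1\<^sub>m m)"
  have R: "?R \<in> carrier_mat (k + m) (k + m)" by (simp add: Qm_def Qk_def)
  have R_right: "?R $$ (a, j) = Q $$ (a, j)" if "a < k + m" "k \<le> j" "j < k + m" for a j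
    using that by (auto simp: Qk_def Qm_def)
  have R_left: "?R $$ (a, j) = (if a = j then 1 else 0)" if "a < k + m" "j < k" for a j
    using that by (auto simp: Qk_def Qm_def)
  have "P * ?R = ?S"
  proof (rule eq_matI)
    fix i j assume "i < dim_row ?S" "j < dim_col ?S"
    then have i: "i < k + m" and j: "j < k + m" by (auto simp: Pk_def)
    have *: "(P * ?R) $$ (i, j) = (\<Sum>a<k + m. P $$ (i, a) * ?R $$ (a, j))"
      by (rule mult_mat_entry[OF P R i j])
    show "(P * ?R) $$ (i, j) = ?S $$ (i, j)"
    proof (cases "j < k")
      case True
      then have "(P * ?R) $$ (i, j) = (\<Sum>a<k + m. if a = j then P $$ (i, a) else 0)"
        unfolding * by (intro sum.cong) (simp_all add: R_left)
      also have "\<dots> = P $$ (i, j)" using j by simp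
      finally show ?thesis using True i by (auto simp: Pk_def Pm_def)
    next
      case False
      then have "(P * ?R) $$ (i, j) = (\<Sum>a<k + m. P $$ (i, a) * Q $$ (a, j))"
        unfolding * using j by (intro sum.cong refl) (simp add: R_right)
      also have "\<dots> = (P * Q) $$ (i, j)"
        by (rule mult_mat_entry[OF P Q i j, symmetric])
      finally show ?thesis using False i j by (auto simp: PQ Pk_def Pm_def)
    qed
  qed (use P in \<open>auto simp: Pk_def Qm_def\<close>)
  then have "det P * det ?R = det ?S" using det_mult[OF P R] by simp
  moreover have "det ?R = det Qm"
    by (subst det_four_block_mat_lower_left_zero[of _ k _ m]) (auto simp: Qk_def Qm_def)
  moreover have "det ?S = det Pk"
    by (subst det_four_block_mat_upper_right_zero[of _ k _ m]) (auto simp: Pk_def Pm_def)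
  ultimately show ?thesis by (simp add: Pk_def Qm_def)
qed

text \<open>The matrix is \<open>e ^ c\<close> times \<open>D * F * D\<close> with \<open>D\<close>
  the diagonal matrix of the powers \<open>e ^ i\<close>, and \<open>det D\<close> squares to 1
  because \<open>e\<close> does.\<close>

lemma det_scale_signs:
  fixes e :: "'a::comm_ring_1"
  assumes "e * e = 1"
  shows "det (mat m m (\<lambda>(i, j). e ^ (c + i + j) * f i j)) = e ^ (c * m) * det (mat m m (\<lambda>(i, j). f i j))"
proof -
  define D where "D = mat m m (\<lambda>(i, j). if i = j then e ^ i else 0)"
  define F where "F = mat m m (\<lambda>(i, j). f i j)"
  have D: "D \<in> carrier_mat m m" and F: "F \<in> carrier_mat m m" by (simp_all add: D_def F_def)
  have "mat m m (\<lambda>(i, j). e ^ (c + i + j) * f i j) = e ^ c \<cdot>\<^sub>m (D * F * D)"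
  proof (rule eq_matI)
    fix i j assume "i < dim_row (e ^ c \<cdot>\<^sub>m (D * F * D))" "j < dim_col (e ^ c \<cdot>\<^sub>m (D * F * D))"
    then have ij: "i < m" "j < m" by (auto simp: D_def)
    have row: "(\<Sum>a<m. D $$ (i, a) * F $$ (a, b)) = e ^ i * F $$ (i, b)" if "b < m" for b
    proof -
      have "(\<Sum>a<m. D $$ (i, a) * F $$ (a, b)) = (\<Sum>a<m. if a = i then e ^ i * F $$ (i, b) else 0)"
        using ij by (intro sum.cong) (auto simp: D_def)
      with ij show ?thesis by simp
    qed
    have "(D * F * D) $$ (i, j) = (\<Sum>b<m. (\<Sum>a<m. D $$ (i, a) * F $$ (a, b)) * D $$ (b, j))"
      by (rule mult_mult_mat_entry[OF D F D ij])
    also have "\<dots> = (\<Sum>b<m. if b = j then e ^ i * F $$ (i, j) * e ^ j else 0)"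
      using ij by (intro sum.cong refl) (simp add: row, simp add: D_def)
    also have "\<dots> = e ^ (i + j) * f i j" using ij by (simp add: F_def power_add ac_simps)
    finally show "mat m m (\<lambda>(i, j). e ^ (c + i + j) * f i j) $$ (i, j) = (e ^ c \<cdot>\<^sub>m (D * F * D)) $$ (i, j)"
      using ij by (simp add: D_def power_add ac_simps)
  qed (simp_all add: D_def)
  moreover have "det D * det D = 1"
  proof -
    have "det D = prod_list (diag_mat D)"
      by (rule det_upper_triangular[OF _ D]) (auto simp: D_def upper_triangular_def)
    also have "\<dots> = (\<Prod>i<m. e ^ i)"
      by (simp add: diag_mat_def D_def prod.list_conv_set_nth lessThan_atLeast0)
    finally show ?thesis
      using assms by (simp flip: prod.distrib power_mult_distrib)
  qed
  moreover have "det (e ^ c \<cdot>\<^sub>m (D * F * D)) = e ^ (c * m) * ((det D * det D) * det F)"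
    using D F by (simp add: det_mult[of _ m] power_mult ac_simps)
  ultimately show ?thesis by (simp add: F_def)
qed

section \<open>Adjacency matrices of paths\<close>

definition path_mat :: "(nat \<Rightarrow> 'a::comm_ring_1) \<Rightarrow> nat \<Rightarrow> 'a mat" where
  "path_mat b n = mat n n (\<lambda>(i, j). if i = j then b i else if i = j + 1 \<or> j = i + 1 then 1 else 0)"

lemma path_mat_carrier [simp]: "path_mat b n \<in> carrier_mat n n"
  by (simp add: path_mat_def)

lemma transpose_path_mat: "(path_mat b n)\<^sup>T = path_mat b n"
  by (rule eq_matI) (auto simp: path_mat_def)

lemma sum_path_row:
  assumes "i < n"
  shows "(\<Sum>a<n. path_mat b n $$ (i, a) * f a) =
    b i * f i + (if i = 0 then 0 else f (i - 1)) + (if i + 1 < n then f (i + 1) else 0)"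
proof -
  have "(\<Sum>a<n. path_mat b n $$ (i, a) * f a) =
    (\<Sum>a<n. (if a = i then b i * f i else 0) + (if i \<noteq> 0 \<and> a = i - 1 then f (i - 1) else 0)
      + (if a = i + 1 then f (i + 1) else 0))"
    using assms by (intro sum.cong refl) (auto simp: path_mat_def)
  also have "\<dots> = b i * f i + (if i = 0 then 0 else f (i - 1)) + (if i + 1 < n then f (i + 1) else 0)"
    using assms by (cases "i = 0") (auto simp: sum.distrib)
  finally show ?thesis .
qed

lemma path_mat_mult_entry:
  assumes "X \<in> carrier_mat n q" "i < n" "j < q"
  shows "(path_mat b n * X) $$ (i, j) = b i * X $$ (i, j)
    + (if i = 0 then 0 else X $$ (i - 1, j)) + (if i + 1 < n then X $$ (i + 1, j) else 0)"
  using assms by (simp add: mult_mat_entry[of _ n n _ q] sum_path_row del: index_mult_mat(1))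

lemma mult_path_mat_entry:
  assumes "X \<in> carrier_mat q n" "i < q" "j < n"
  shows "(X * path_mat b n) $$ (i, j) = b j * X $$ (i, j)
    + (if j = 0 then 0 else X $$ (i, j - 1)) + (if j + 1 < n then X $$ (i, j + 1) else 0)"
proof -
  have "X * path_mat b n = (path_mat b n * X\<^sup>T)\<^sup>T"
    using assms by (simp add: transpose_mult[of _ n n _ q] transpose_path_mat)
  then have "(X * path_mat b n) $$ (i, j) = (path_mat b n * X\<^sup>T) $$ (j, i)"
    using assms by (simp add: path_mat_def)
  then show ?thesis
    using assms by (simp add: path_mat_mult_entry[of _ n q] del: index_mult_mat(1))
qed

text \<open>The continuant recurrence. The last row has two nonzero off-diagonal or diagonal
  positions at most; the minor \<open>X\<close> belonging to the off-diagonal one has a single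
  nonzero entry in its last column, so a second expansion leaves the path with two vertices
  fewer.\<close>

lemma det_path_mat_Suc_Suc:
  "det (path_mat b (Suc (Suc n))) = b (Suc n) * det (path_mat b (Suc n)) - det (path_mat b n)"
proof -
  let ?M = "path_mat b (Suc (Suc n))"
  define X where "X = mat_delete ?M (Suc n) n"
  have X: "X \<in> carrier_mat (Suc n) (Suc n)"
    using mat_delete_carrier[of ?M "Suc (Suc n)" "Suc (Suc n)"] by (simp add: X_def)
  have "det X = (\<Sum>i<Suc n. X $$ (i, n) * cofactor X i n)"
    by (rule laplace_expansion_column[OF X]) simp
  also have "\<dots> = (\<Sum>i<Suc n. if i = n then cofactor X n n else 0)"
    by (intro sum.cong refl) (auto simp: X_def mat_delete_def path_mat_def)
  also have "\<dots> = det (mat_delete X n n)" by (simp add: cofactor_def)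
  also have "mat_delete X n n = path_mat b n"
    by (rule eq_matI) (auto simp: X_def mat_delete_def path_mat_def)
  finally have detX: "det X = det (path_mat b n)" .
  have del: "mat_delete ?M (Suc n) (Suc n) = path_mat b (Suc n)"
    by (rule eq_matI) (auto simp: mat_delete_def path_mat_def)
  have "det ?M = (\<Sum>j<Suc (Suc n). ?M $$ (Suc n, j) * cofactor ?M (Suc n) j)"
    by (rule laplace_expansion_row) simp_all
  also have "\<dots> = b (Suc n) * cofactor ?M (Suc n) (Suc n) + cofactor ?M (Suc n) n"
    by (subst sum_path_row) simp_all
  also have "\<dots> = b (Suc n) * det (path_mat b (Suc n)) - det (path_mat b n)"
    by (simp add: cofactor_def del detX flip: X_def)
  finally show ?thesis .
qed

lemma det_path_mat_zero_diagonal: "det (path_mat (\<lambda>_. 0) (2 * n)) = (- 1) ^ n"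
proof (induction n)
  case (Suc n)
  then show ?case by (simp add: det_path_mat_Suc_Suc)
qed simp

definition loop :: "nat \<Rightarrow> 'a::zero_neq_one" where
  "loop i = (if i = 0 then 1 else 0)"

text \<open>Only vertex 0 has a loop, so two further vertices just change the sign, in agreement
  with the odd increment \<open>2 * n + 1\<close> of the binomial coefficient.\<close>

lemma det_path_mat_loop: "det (path_mat loop n) = (- 1) ^ (n choose 2)"
proof (induction n rule: induct_nat_012)
  case 1
  show ?case
    by (subst det_single) (auto simp: path_mat_def loop_def numeral_2_eq_2)
next
  case (ge2 n)
  have "Suc (Suc n) choose 2 = (n choose 2) + 2 * n + 1"
    by (simp add: numeral_2_eq_2)
  then show ?case
    using ge2 by (simp add: det_path_mat_Suc_Suc loop_def power_add)
qed (simp add: numeral_2_eq_2)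

section \<open>Walks from vertex 0 and Hankel determinants as leading minors\<close>

text \<open>A walk of \<open>i\<close> steps from vertex 0 gets no further than vertex
  \<open>i\<close>, and only the straight walk gets that far.\<close>

lemma path_mat_pow_row_0:
  assumes "l < n" "i \<le> l"
  shows "(path_mat b n ^\<^sub>m i) $$ (0, l) = (if l = i then 1 else 0)"
  using assms
proof (induction i arbitrary: l)
  case 0
  then show ?case by (auto simp: path_mat_def)
next
  case (Suc i)
  have "(path_mat b n ^\<^sub>m Suc i) $$ (0, l) = b l * (path_mat b n ^\<^sub>m i) $$ (0, l)
    + (path_mat b n ^\<^sub>m i) $$ (0, l - 1) + (if l + 1 < n then (path_mat b n ^\<^sub>m i) $$ (0, l + 1) else 0)"
    using Suc.prems by (simp add: mult_path_mat_entry[of _ n n] del: index_mult_mat(1))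
  then show ?case using Suc by auto
qed

text \<open>Each entry is the bilinear form of \<open>P\<close> at the rows with index 0 of two
  powers of the path matrix. By \<open>path_mat_pow_row_0\<close> the first \<open>k\<close> such
  rows form a unitriangular matrix \<open>T\<close> on the first \<open>k\<close> coordinates, which
  does not affect the determinant. If \<open>P\<close> is itself a power of the path matrix, the
  left side is a Hankel determinant.\<close>

lemma det_krylov:
  fixes P :: "'a::idom mat"
  assumes P: "P \<in> carrier_mat n n" and "k \<le> n"
  shows "det (mat k k (\<lambda>(i, j). (path_mat b n ^\<^sub>m i * P * path_mat b n ^\<^sub>m j) $$ (0, 0))) =
    det (mat k k (\<lambda>(i, j). P $$ (i, j)))"
proof -
  let ?C = "path_mat b n"
  define t where "t i a = (?C ^\<^sub>m i) $$ (0, a)" for i a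
  define T where "T = mat k k (\<lambda>(i, a). t i a)"
  define Pk where "Pk = mat k k (\<lambda>(i, j). P $$ (i, j))"
  have T: "T \<in> carrier_mat k k" and Pk: "Pk \<in> carrier_mat k k" by (simp_all add: T_def Pk_def)
  have t0: "t i a = 0" if "i < a" "a < n" for i a
    using that by (simp add: t_def path_mat_pow_row_0)
  have t1: "t i i = 1" if "i < n" for i
    using that by (simp add: t_def path_mat_pow_row_0)
  have "mat k k (\<lambda>(i, j). (?C ^\<^sub>m i * P * ?C ^\<^sub>m j) $$ (0, 0)) = T * Pk * T\<^sup>T"
  proof (rule eq_matI)
    fix i j assume "i < dim_row (T * Pk * T\<^sup>T)" "j < dim_col (T * Pk * T\<^sup>T)"
    then have i: "i < k" and j: "j < k" by (simp_all add: T_def)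
    then have n: "0 < n" using \<open>k \<le> n\<close> by simp
    have cut: "(\<Sum>a<n. t i a * f a) = (\<Sum>a<k. t i a * f a)" if "i < k" for i f
      using that \<open>k \<le> n\<close> by (intro sum.mono_neutral_right) (auto simp: t0)
    have t_col: "(?C ^\<^sub>m j) $$ (a, 0) = t j a" if "a < n" for a
    proof -
      have "(?C ^\<^sub>m j) $$ (a, 0) = (?C ^\<^sub>m j)\<^sup>T $$ (0, a)"
        using that n pow_carrier_mat[of ?C n j] carrier_matD[of "?C ^\<^sub>m j" n n] by simp
      then show ?thesis
        by (simp add: transpose_pow_mat[of _ n] transpose_path_mat t_def)
    qed
    have "(?C ^\<^sub>m i * P * ?C ^\<^sub>m j) $$ (0, 0) =
      (\<Sum>c<n. (\<Sum>a<n. t i a * P $$ (a, c)) * (?C ^\<^sub>m j) $$ (c, 0))"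
      unfolding t_def using P n by (intro mult_mult_mat_entry[of _ n n]) simp_all
    also have "\<dots> = (\<Sum>c<n. t j c * (\<Sum>a<k. t i a * P $$ (a, c)))"
      using i by (intro sum.cong refl) (simp add: cut t_col)
    also have "\<dots> = (\<Sum>c<k. (\<Sum>a<k. t i a * P $$ (a, c)) * t j c)"
      using j by (simp add: cut mult.commute)
    also have "\<dots> = (T * Pk * T\<^sup>T) $$ (i, j)"
      using i j T Pk
      by (subst mult_mult_mat_entry[of _ k k _ k _ k]) (simp_all add: T_def Pk_def)
    finally show "mat k k (\<lambda>(i, j). (?C ^\<^sub>m i * P * ?C ^\<^sub>m j) $$ (0, 0)) $$ (i, j)
      = (T * Pk * T\<^sup>T) $$ (i, j)"
      using i j by simp
  qed (simp_all add: T_def)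
  moreover have "det T = 1"
  proof -
    have "diag_mat T = map (\<lambda>_. 1) [0..<k]"
      using t1 \<open>k \<le> n\<close> by (auto simp: diag_mat_def T_def)
    moreover have "prod_list (map (\<lambda>_. 1 :: 'a) [0..<k]) = 1" by (induction k) auto
    moreover have "det T = prod_list (diag_mat T)"
      using t0 \<open>k \<le> n\<close> by (intro det_lower_triangular[OF _ T]) (auto simp: T_def)
    ultimately show ?thesis by simp
  qed
  ultimately show ?thesis
    using T Pk by (simp add: det_mult[of _ k] det_transpose[of _ k] Pk_def)
qed

section \<open>Powers of the path with a loop\<close>

text \<open>Column 0 of \<open>B\<close> consists of ones and its last row is the unit vector at 0.
  As \<open>B\<close> commutes with \<open>C\<close>, it commutes with every integer power, and
  comparing the entries at \<open>(n - 1, 0)\<close> of the two products gives the claim.\<close>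

lemma sum_top_row_zpow:
  fixes C C' :: "'a::comm_ring_1 mat"
  assumes "0 < n" and C: "C = path_mat loop n" and pair: "inverse_pair n C C'"
  shows "(\<Sum>l<n. zpow C C' z $$ (n - 1, l)) = zpow C C' z $$ (0, 0)"
proof -
  interpret inverse_pair n C C' by fact
  define B :: "'a mat" where "B = mat n n (\<lambda>(i, j). if i + j < n then 1 else 0)"
  have B: "B \<in> carrier_mat n n" by (simp add: B_def)
  have "C * B = B * C"
  proof (rule eq_matI)
    fix i j assume "i < dim_row (B * C)" "j < dim_col (B * C)"
    then have ij: "i < n" "j < n" using B by (auto simp: C path_mat_def)
    \<comment> \<open>The loop acts like a neighbour to the left of vertex 0 carrying the same
      value, so both products equal this expression, which is symmetric in \<open>i\<close> and
      \<open>j\<close>.\<close>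
    let ?g = "(if i + j < n + 1 then 1 else 0) + (if i + j + 1 < n then 1 else 0) :: 'a"
    have "(C * B) $$ (i, j) = loop i * B $$ (i, j)
      + (if i = 0 then 0 else B $$ (i - 1, j)) + (if i + 1 < n then B $$ (i + 1, j) else 0)"
      unfolding C using B ij by (rule path_mat_mult_entry)
    also have "\<dots> = ?g"
      using ij by (cases i) (simp_all add: B_def loop_def)
    finally have "(C * B) $$ (i, j) = ?g" .
    moreover have "(B * C) $$ (i, j) = loop j * B $$ (i, j)
      + (if j = 0 then 0 else B $$ (i, j - 1)) + (if j + 1 < n then B $$ (i, j + 1) else 0)"
      unfolding C using B ij by (rule mult_path_mat_entry)
    moreover have "\<dots> = ?g"
      using ij by (cases j) (simp_all add: B_def loop_def)
    ultimately show "(C * B) $$ (i, j) = (B * C) $$ (i, j)" by simp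
  qed (use B in \<open>auto simp: C path_mat_def\<close>)
  then have "zpow C C' z * B = B * zpow C C' z"
    by (rule zpow_intertwine[OF pair pair B])
  then have "(zpow C C' z * B) $$ (n - 1, 0) = (B * zpow C C' z) $$ (n - 1, 0)" by simp
  then have "(\<Sum>l<n. zpow C C' z $$ (n - 1, l) * B $$ (l, 0)) =
    (\<Sum>l<n. B $$ (n - 1, l) * zpow C C' z $$ (l, 0))"
    using B \<open>0 < n\<close> by (simp add: mult_mat_entry[of _ n n _ n] del: index_mult_mat(1))
  moreover have "(\<Sum>l<n. B $$ (n - 1, l) * zpow C C' z $$ (l, 0)) =
    (\<Sum>l<n. if l = 0 then zpow C C' z $$ (0, 0) else 0)"
    by (intro sum.cong) (auto simp: B_def)
  ultimately show ?thesis using \<open>0 < n\<close> by (simp add: B_def)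
qed

text \<open>\<open>F\<close> folds the long path in the middle: vertices \<open>n - 1 - i\<close>
  and \<open>n + i\<close> go to vertex \<open>i\<close>, and the middle edge becomes the loop at 0.
  Each row of \<open>F\<close> contains exactly one 1, so row sums survive the folding, while the
  end vertex 0 goes to \<open>n - 1\<close>, where \<open>sum_top_row_zpow\<close> applies.\<close>

lemma sum_bottom_row_zpow:
  fixes A A' C C' :: "'a::comm_ring_1 mat"
  assumes "0 < n" and A: "A = path_mat (\<lambda>_. 0) (2 * n)" and pairA: "inverse_pair (2 * n) A A'"
    and C: "C = path_mat loop n" and pairC: "inverse_pair n C C'"
  shows "(\<Sum>s<2 * n. zpow A A' z $$ (0, s)) = zpow C C' z $$ (0, 0)"
proof -
  interpret A: inverse_pair "2 * n" A A' by fact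
  interpret C: inverse_pair n C C' by fact
  define F :: "'a mat" where
    "F = mat (2 * n) n (\<lambda>(h, i). if h + i + 1 = n \<or> h = n + i then 1 else 0)"
  have F: "F \<in> carrier_mat (2 * n) n" by (simp add: F_def)
  have "A * F = F * C"
  proof (rule eq_matI)
    fix h i assume "h < dim_row (F * C)" "i < dim_col (F * C)"
    then have h: "h < 2 * n" and i: "i < n" using F by (auto simp: C path_mat_def)
    have "(A * F) $$ (h, i) = 0 * F $$ (h, i)
      + (if h = 0 then 0 else F $$ (h - 1, i)) + (if h + 1 < 2 * n then F $$ (h + 1, i) else 0)"
      unfolding A using F h i by (rule path_mat_mult_entry)
    moreover have "(F * C) $$ (h, i) = loop i * F $$ (h, i)
      + (if i = 0 then 0 else F $$ (h, i - 1)) + (if i + 1 < n then F $$ (h, i + 1) else 0)"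
      unfolding C using F h i by (rule mult_path_mat_entry)
    moreover have "0 * F $$ (h, i)
      + (if h = 0 then 0 else F $$ (h - 1, i)) + (if h + 1 < 2 * n then F $$ (h + 1, i) else 0) =
      loop i * F $$ (h, i)
      + (if i = 0 then 0 else F $$ (h, i - 1)) + (if i + 1 < n then F $$ (h, i + 1) else 0)"
      using h i by (cases h; cases i) (auto simp: F_def loop_def)
    ultimately show "(A * F) $$ (h, i) = (F * C) $$ (h, i)" by simp
  qed (use F in \<open>auto simp: A C path_mat_def\<close>)
  then have AF: "zpow A A' z * F = F * zpow C C' z"
    by (rule zpow_intertwine[OF pairA pairC F])
  have "(\<Sum>s<2 * n. zpow A A' z $$ (0, s)) =
    (\<Sum>s<2 * n. \<Sum>l<n. zpow A A' z $$ (0, s) * F $$ (s, l))"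
  proof (intro sum.cong refl)
    fix s assume s: "s \<in> {..<2 * n}"
    \<comment> \<open>The image of vertex \<open>s\<close> under the folding.\<close>
    define l0 where "l0 = (if s < n then n - 1 - s else s - n)"
    have "l0 < n" using s by (auto simp: l0_def)
    have "(\<Sum>l<n. zpow A A' z $$ (0, s) * F $$ (s, l)) =
      (\<Sum>l<n. if l = l0 then zpow A A' z $$ (0, s) else 0)"
      using s by (intro sum.cong) (auto simp: F_def l0_def)
    then show "zpow A A' z $$ (0, s) = (\<Sum>l<n. zpow A A' z $$ (0, s) * F $$ (s, l))"
      using \<open>l0 < n\<close> by simp
  qed
  also have "\<dots> = (\<Sum>l<n. (zpow A A' z * F) $$ (0, l))"
    using F \<open>0 < n\<close>
    by (subst sum.swap) (simp add: mult_mat_entry[of _ "2 * n" "2 * n" _ n] del: index_mult_mat(1))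
  also have "\<dots> = (\<Sum>l<n. zpow C C' z $$ (n - 1, l))"
  proof (intro sum.cong refl)
    fix l assume l: "l \<in> {..<n}"
    have "(F * zpow C C' z) $$ (0, l) = (\<Sum>a<n. F $$ (0, a) * zpow C C' z $$ (a, l))"
      using F \<open>0 < n\<close> l by (intro mult_mat_entry) auto
    also have "\<dots> = (\<Sum>a<n. if a = n - 1 then zpow C C' z $$ (n - 1, l) else 0)"
      using \<open>0 < n\<close> by (intro sum.cong) (auto simp: F_def)
    finally show "(zpow A A' z * F) $$ (0, l) = zpow C C' z $$ (n - 1, l)"
      using \<open>0 < n\<close> by (simp add: AF del: index_mult_mat(1))
  qed
  also have "\<dots> = zpow C C' z $$ (0, 0)"
    by (rule sum_top_row_zpow) fact+
  finally show ?thesis .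
qed

section \<open>Negative powers at the end without loop\<close>

text \<open>For \<open>a < N\<close> this is the sum of row \<open>a\<close> of the
  \<open>n\<close>-th power of \<open>([a + b < N])\<close>. Measuring entries alternately from the
  bottom and from the top of the range turns both kinds of comparison into \<open>a + b < N\<close>,
  so one recursion serves up and down steps.\<close>

fun alt_count :: "nat \<Rightarrow> nat \<Rightarrow> nat \<Rightarrow> nat" where
  "alt_count N 0 a = 1"
| "alt_count N (Suc n) a = (\<Sum>b<N - a. alt_count N n b)"

declare alt_count.simps(2) [simp del]

text \<open>Rows \<open>a\<close> and \<open>Suc a\<close> of \<open>([a + b < N])\<close> differ
  only at \<open>b = N - Suc a\<close>. Such differences are how the path matrix undoes the
  summation.\<close>

lemma alt_count_Suc_diff:
  assumes "a < N"
  shows "alt_count N (Suc n) a = alt_count N (Suc n) (Suc a) + alt_count N n (N - Suc a)"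
proof -
  have "N - a = Suc (N - Suc a)" using assms by simp
  then show ?thesis by (simp only: alt_count.simps(2) sum.lessThan_Suc)
qed

text \<open>Listing the vertices from the end without loop, vertex \<open>q\<close> takes the label \<open>0, N - 1, 1, N - 2, \<dots>\<close>;
  in these labels the inverse of the loop path is \<open>([a + b < N])\<close> up to signs.\<close>

definition alt_vec :: "nat \<Rightarrow> nat \<Rightarrow> nat \<Rightarrow> 'a::comm_ring_1" where
  "alt_vec N n q = (- 1) ^ ((N + 1) * (n + 1 + q) + q div 2) *
     of_nat (alt_count N n (if even q then q div 2 else N - (q + 1) div 2))"

text \<open>Positions \<open>q - 1\<close> and \<open>q + 1\<close> have consecutive labels and
  opposite signs, so the sum is a difference as in \<open>alt_count_Suc_diff\<close>. At
  \<open>q = 0\<close> the only neighbour has label \<open>N - 1\<close>, whose row sum has a single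
  term.\<close>

lemma alt_vec_Suc:
  assumes "q < N"
  shows "(if q = 0 then 0 else alt_vec N (Suc n) (q - 1)) + alt_vec N (Suc n) (q + 1) = alt_vec N n q"
proof (cases "even q")
  case True
  then obtain t where t: "q = 2 * t" by (elim evenE)
  show ?thesis
  proof (cases t)
    case 0
    then show ?thesis
      using assms t
      by (cases "even n"; cases "even N") (simp_all add: alt_vec_def alt_count.simps(2) minus_one_power_iff)
  next
    case (Suc r)
    then show ?thesis
      using assms t alt_count_Suc_diff[of "N - Suc t" N n]
      by (simp add: alt_vec_def minus_one_power_iff Suc_diff_Suc)
  qed
next
  case False
  then obtain t where t: "q = 2 * t + 1" by (elim oddE)
  then show ?thesis
    using assms alt_count_Suc_diff[of t N n]
    by (simp add: alt_vec_def minus_one_power_iff)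
qed

text \<open>All counts are 1 and the two neighbours have opposite signs; only at
  \<open>q = 0\<close> is there nothing to cancel.\<close>

lemma alt_vec_0:
  "(if q = 0 then 0 else alt_vec N 0 (q - 1)) + alt_vec N 0 (q + 1) = (if q = 0 then 1 else 0)"
proof (cases "even q")
  case True
  then obtain t where t: "q = 2 * t" by (elim evenE)
  then show ?thesis by (cases t) (simp_all add: alt_vec_def minus_one_power_iff)
next
  case False
  then obtain t where t: "q = 2 * t + 1" by (elim oddE)
  then show ?thesis by (simp add: alt_vec_def minus_one_power_iff)
qed

text \<open>Positions \<open>N - 1\<close> and \<open>N\<close> have equal label and sign. Hence the
  loop term can be read as a neighbour beyond the end, and the recursions for \<open>alt_vec\<close>
  also cover the loop vertex.\<close>

lemma alt_vec_fold:
  assumes "0 < N"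
  shows "alt_vec N n N = alt_vec N n (N - 1)"
proof (cases "even N")
  case True
  then obtain t where t: "N = 2 * t" by (elim evenE)
  with assms show ?thesis by (cases t) (simp_all add: alt_vec_def minus_one_power_iff)
next
  case False
  then obtain t where t: "N = 2 * t + 1" by (elim oddE)
  then show ?thesis by (simp add: alt_vec_def minus_one_power_iff)
qed

text \<open>The columns \<open>V n\<close> satisfy \<open>C * V (Suc n) = V n\<close> and
  \<open>C * V 0 = E\<close>, the unit column at the end without loop. So \<open>V n\<close> is that
  column of the power with exponent \<open>- int n - 1\<close>, and its last entry is
  \<open>alt_vec N n 0\<close>.\<close>

lemma zpow_loop_corner:
  fixes C C' :: "'a::comm_ring_1 mat"
  assumes "0 < N" and C: "C = path_mat loop N" and pair: "inverse_pair N C C'"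
  shows "zpow C C' (- int n - 1) $$ (N - 1, N - 1) =
    (- 1) ^ ((N + 1) * (n + 1)) * of_nat (alt_count N n 0)"
proof -
  interpret inverse_pair N C C' by fact
  define V :: "nat \<Rightarrow> 'a mat" where "V n = mat N 1 (\<lambda>(i, _). alt_vec N n (N - 1 - i))" for n
  define E :: "'a mat" where "E = mat N 1 (\<lambda>(i, _). if i = N - 1 then 1 else 0)"
  have V: "V n \<in> carrier_mat N 1" and E: "E \<in> carrier_mat N 1" for n
    by (simp_all add: V_def E_def)
  have CV_entry: "(C * V n) $$ (i, 0) =
      (if N - 1 - i = 0 then 0 else alt_vec N n (N - 1 - i - 1)) + alt_vec N n (N - 1 - i + 1)"
    if "i < N" for n i
    using that V[of n] alt_vec_fold[of N n, where ?'a = 'a] unfolding C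
    by (subst path_mat_mult_entry[of _ N 1]) (auto simp: V_def loop_def Suc_diff_Suc)
  have "C * V (Suc n) = V n" for n
  proof (rule eq_matI)
    fix i j assume "i < dim_row (V n)" "j < dim_col (V n)"
    then show "(C * V (Suc n)) $$ (i, j) = V n $$ (i, j)"
      using CV_entry[of i "Suc n"] alt_vec_Suc[of "N - 1 - i" N n, where ?'a = 'a]
      by (simp add: V_def del: index_mult_mat(1))
  qed (simp_all add: V_def C path_mat_def)
  then have V_Suc: "V (Suc n) = C' * V n" for n
    using carrier V[of "Suc n"] left_inv
    by (metis assoc_mult_mat left_mult_one_mat)
  have "C * V 0 = E"
  proof (rule eq_matI)
    fix i j assume "i < dim_row E" "j < dim_col E"
    then show "(C * V 0) $$ (i, j) = E $$ (i, j)"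
      using CV_entry[of i 0] alt_vec_0[of "N - 1 - i" N, where ?'a = 'a]
      by (auto simp: E_def simp del: index_mult_mat(1) split: if_splits)
  qed (simp_all add: V_def E_def C path_mat_def)
  then have V_0: "V 0 = C' * E"
    using carrier V[of 0] left_inv by (metis assoc_mult_mat left_mult_one_mat)
  have V_pow: "V n = C' ^\<^sub>m Suc n * E" for n
  proof (induction n)
    case (Suc n)
    have "V (Suc n) = C' * (C' ^\<^sub>m Suc n * E)" using Suc V_Suc by simp
    also have "\<dots> = C' ^\<^sub>m Suc (Suc n) * E"
      using carrier E pow_mat_Suc_left[of C' N "Suc n"]
      by (simp add: assoc_mult_mat[of C' N N "C' ^\<^sub>m Suc n" N E 1] del: pow_mat.simps(2))
    finally show ?case .
  qed (use V_0 carrier in simp)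
  have "- int n - 1 = - int (Suc n)" by simp
  then have "zpow C C' (- int n - 1) = C' ^\<^sub>m Suc n" by (simp only: zpow_minus_of_nat)
  then have "zpow C C' (- int n - 1) * E = V n" using V_pow by simp
  then have "(\<Sum>a<N. zpow C C' (- int n - 1) $$ (N - 1, a) * E $$ (a, 0)) = V n $$ (N - 1, 0)"
    using E \<open>0 < N\<close> by (simp flip: mult_mat_entry[of _ N N _ 1])
  moreover have "(\<Sum>a<N. zpow C C' (- int n - 1) $$ (N - 1, a) * E $$ (a, 0)) =
    (\<Sum>a<N. if a = N - 1 then zpow C C' (- int n - 1) $$ (N - 1, N - 1) else 0)"
    by (intro sum.cong) (auto simp: E_def)
  ultimately show ?thesis
    using \<open>0 < N\<close> by (simp add: V_def alt_vec_def)
qed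

section \<open>Alternating sequences\<close>

text \<open>The continuations \<open>a\<close> of a sequence that ends in \<open>x\<close>; the flag \<open>u\<close> says that the next step goes up.\<close>

definition alt_from :: "nat \<Rightarrow> nat \<Rightarrow> bool \<Rightarrow> int \<Rightarrow> int list set" where
  "alt_from K n u x =
     {a. length a = n \<and> (\<forall>y\<in>set a. 1 \<le> y \<and> y \<le> int K) \<and>
         (\<forall>i<n. if even i = u then (x # a) ! i \<le> a ! i else (x # a) ! i \<ge> a ! i)}"

lemma alt_from_0: "alt_from K 0 u x = {[]}"
  by (auto simp: alt_from_def)

lemma alt_from_Suc:
  "alt_from K (Suc n) u x =
     (\<lambda>(y, a). y # a) ` (SIGMA y:{y \<in> {1..int K}. if u then x \<le> y else y \<le> x}. alt_from K n (\<not> u) y)"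
proof (rule Set.set_eqI)
  fix a
  show "a \<in> alt_from K (Suc n) u x \<longleftrightarrow> a \<in> (\<lambda>(y, a). y # a) `
    (SIGMA y:{y \<in> {1..int K}. if u then x \<le> y else y \<le> x}. alt_from K n (\<not> u) y)"
  proof (cases a)
    case (Cons y l)
    have "y # l \<in> alt_from K (Suc n) u x \<longleftrightarrow>
        y \<in> {y \<in> {1..int K}. if u then x \<le> y else y \<le> x} \<and> l \<in> alt_from K n (\<not> u) y"
      by (auto simp: alt_from_def All_less_Suc2)
    then show ?thesis unfolding Cons by (auto simp only: image_iff mem_Sigma_iff split_beta Bex_def list.inject fst_conv snd_conv)
  qed (auto simp: alt_from_def)
qed

lemma finite_alt_from: "finite (alt_from K n u x)"
  by (rule finite_subset[OF _ finite_lists_length_eq[of "{1..int K}" n]]) (auto simp: alt_from_def)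

text \<open>The label of \<open>x\<close> is its distance from the bottom before an up step and from
  the top before a down step. In the labels of the next entry, the admissible values are
  \<open>b < K - a\<close> in both cases.\<close>

lemma card_alt_from:
  assumes "x \<in> {1..int K}"
  shows "card (alt_from K n u x) = alt_count K n (if u then nat x - 1 else K - nat x)"
  using assms
proof (induction n arbitrary: u x)
  case (Suc n)
  let ?Y = "{y \<in> {1..int K}. if u then x \<le> y else y \<le> x}"
  have "finite ?Y" by (rule finite_subset[of _ "{1..int K}"]) auto
  then have "card (alt_from K (Suc n) u x) = (\<Sum>y\<in>?Y. card (alt_from K n (\<not> u) y))"
    unfolding alt_from_Suc
    by (subst card_image) (auto simp: inj_on_def finite_alt_from intro!: card_SigmaI)
  also have "\<dots> = (\<Sum>y\<in>?Y. alt_count K n (if u then K - nat y else nat y - 1))"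
    using Suc.IH by (intro sum.cong) auto
  also have "\<dots> = (\<Sum>b<K - (if u then nat x - 1 else K - nat x). alt_count K n b)"
  proof (cases u)
    case True
    have "(\<Sum>y\<in>{y \<in> {1..int K}. x \<le> y}. alt_count K n (K - nat y)) = (\<Sum>b<K - (nat x - 1). alt_count K n b)"
      using Suc.prems
      by (intro sum.reindex_bij_witness[of _ "\<lambda>b. int (K - b)" "\<lambda>y. K - nat y"])
        (simp_all, linarith+)
    with True show ?thesis by simp
  next
    case False
    obtain X where X: "x = int X" "X \<le> K" using Suc.prems by (intro that[of "nat x"]) auto
    have "{y \<in> {1..int K}. y \<le> x} = (\<lambda>b. int (Suc b)) ` {..<X}"
    proof
      show "{y \<in> {1..int K}. y \<le> x} \<subseteq> (\<lambda>b. int (Suc b)) ` {..<X}"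
      proof
        fix y assume "y \<in> {y \<in> {1..int K}. y \<le> x}"
        then show "y \<in> (\<lambda>b. int (Suc b)) ` {..<X}"
          using X by (intro image_eqI[of _ _ "nat (y - 1)"]) auto
      qed
    qed (use X in auto)
    then have "(\<Sum>y\<in>{y \<in> {1..int K}. y \<le> x}. alt_count K n (nat y - 1)) = (\<Sum>b<X. alt_count K n b)"
      by (simp add: sum.reindex inj_on_def nat_add_distrib)
    moreover have "K - (K - nat x) = X" using X by simp
    ultimately show ?thesis using False by simp
  qed
  finally show ?case by (simp add: alt_count.simps(2))
qed (simp add: alt_from_0)

lemma card_alt_seqs:
  assumes "0 < K"
  shows "card (alt_seqs K n) = alt_count K n 0"
proof -
  \<comment> \<open>A fictitious entry \<open>K\<close> followed by a down step leaves the first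
    entry unrestricted; its label is 0.\<close>
  have "alt_seqs K n = alt_from K n False (int K)"
  proof (cases n)
    case (Suc n')
    then show ?thesis
      by (auto simp: alt_seqs_def alt_from_def All_less_Suc2)
  qed (auto simp: alt_seqs_def alt_from_def)
  then show ?thesis using assms by (simp add: card_alt_from)
qed

section \<open>Bounded Motzkin paths\<close>

lemma motzkin_path_snoc:
  "motzkin_path (ps @ [q]) \<longleftrightarrow> ps = [] \<or> motzkin_path ps \<and> motzkin_step (last ps) q"
proof (cases "ps = []")
  case False
  then obtain n where n: "length ps = Suc n" by (cases ps) auto
  have "motzkin_path (ps @ [q]) \<longleftrightarrow>
      (\<forall>i<Suc n. motzkin_step ((ps @ [q]) ! i) ((ps @ [q]) ! Suc i))"
    by (simp add: motzkin_path_def n)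
  also have "\<dots> \<longleftrightarrow> (\<forall>i<n. motzkin_step (ps ! i) (ps ! Suc i)) \<and> motzkin_step (ps ! n) q"
    unfolding All_less_Suc by (auto simp: nth_append n)
  finally show ?thesis
    using False by (simp add: motzkin_path_def last_conv_nth n)
qed (simp add: motzkin_path_def)

lemma motzkin_path_length:
  "motzkin_path ps \<Longrightarrow> fst (last ps) = fst (hd ps) + int (length ps - 1)"
proof (induction ps rule: rev_induct)
  case (snoc q ps)
  then show ?case
    by (cases "ps = []") (auto simp: motzkin_path_snoc motzkin_step_def Suc_le_eq of_nat_diff)
qed (simp add: motzkin_path_def)

lemma path_weight_snoc:
  assumes "ps \<noteq> []"
  shows "path_weight b l (ps @ [q]) = path_weight b l ps * step_weight b l (last ps) q"
proof -
  obtain n where n: "length ps = Suc n" using assms by (cases ps) auto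
  have "(\<Prod>i<n. step_weight b l ((ps @ [q]) ! i) ((ps @ [q]) ! Suc i)) =
    (\<Prod>i<n. step_weight b l (ps ! i) (ps ! Suc i))"
    by (intro prod.cong) (auto simp: nth_append n)
  then show ?thesis
    using assms by (simp add: path_weight_def last_conv_nth nth_append n)
qed

lemma bounded_paths_0:
  assumes "r \<le> K"
  shows "bounded_paths K 0 r s = (if r = s then {[(0, r)]} else {})"
proof -
  have "ps = [(0, r)] \<and> r = s" if "ps \<in> bounded_paths K 0 r s" for ps
  proof -
    have ps: "motzkin_path ps" "hd ps = (0, r)" "last ps = (0, s)"
      using that by (auto simp: bounded_paths_def)
    then have "length ps - 1 = 0" "ps \<noteq> []"
      using motzkin_path_length[of ps] by (auto simp: motzkin_path_def)
    then have "length ps = 1" by (simp add: Suc_leI le_antisym)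
    with ps show ?thesis by (auto simp: length_Suc_conv)
  qed
  moreover have "[(0, r)] \<in> bounded_paths K 0 r r"
    using assms by (simp add: bounded_paths_def motzkin_path_def)
  ultimately show ?thesis by auto
qed

lemma bounded_paths_Suc:
  assumes "s \<le> K"
  shows "bounded_paths K (Suc n) r s =
    (\<Union>t\<in>{t. t \<le> K \<and> int s - int t \<in> {1, 0, -1}}. (\<lambda>ps. ps @ [(int (Suc n), s)]) ` bounded_paths K n r t)"
  (is "?L = ?R")
proof
  show "?L \<subseteq> ?R"
  proof
    fix ps assume ps: "ps \<in> ?L"
    then have path: "motzkin_path ps" "hd ps = (0, r)" "last ps = (int (Suc n), s)"
      by (auto simp: bounded_paths_def)
    then obtain qs where qs: "ps = qs @ [(int (Suc n), s)]"
      by (metis append_butlast_last_id motzkin_path_def)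
    have "qs \<noteq> []" using path(2) qs by auto
    then have q: "motzkin_path qs" "motzkin_step (last qs) (int (Suc n), s)"
      using path(1) by (auto simp: qs motzkin_path_snoc)
    obtain x t where xt: "last qs = (x, t)" by (cases "last qs")
    then have x: "x = int n" "int s - int t \<in> {1, 0, -1}" using q(2) by (auto simp: motzkin_step_def)
    have "(x, t) \<in> set qs" using \<open>qs \<noteq> []\<close> xt by (metis last_in_set)
    then have "t \<le> K" using ps qs by (auto simp: bounded_paths_def)
    moreover have "qs \<in> bounded_paths K n r t"
      using ps qs \<open>qs \<noteq> []\<close> q(1) xt x by (auto simp: bounded_paths_def)
    ultimately show "ps \<in> ?R" using qs x by auto
  qed
  show "?R \<subseteq> ?L"
    using assms by (auto simp: bounded_paths_def motzkin_path_snoc motzkin_step_def hd_append motzkin_path_def[of "[]"])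
qed

lemma finite_bounded_paths: "r \<le> K \<Longrightarrow> s \<le> K \<Longrightarrow> finite (bounded_paths K n r s)"
proof (induction n arbitrary: s)
  case (Suc n)
  have "finite {t. t \<le> K \<and> int s - int t \<in> {1, 0, -1}}"
    by (rule finite_subset[of _ "{..K}"]) auto
  with Suc show ?case by (auto simp: bounded_paths_Suc)
qed (simp add: bounded_paths_0)

lemma bounded_moment_0: "r \<le> K \<Longrightarrow> bounded_moment K b l 0 r s = (if r = s then 1 else 0)"
  by (simp add: bounded_moment_def bounded_paths_0 path_weight_def)

lemma bounded_moment_Suc:
  assumes "r \<le> K" "s \<le> K"
  shows "bounded_moment K b l (Suc n) r s =
    (\<Sum>t | t \<le> K \<and> int s - int t \<in> {1, 0, -1}.
      bounded_moment K b l n r t * step_weight b l (int n, t) (int (Suc n), s))"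
proof -
  let ?T = "{t. t \<le> K \<and> int s - int t \<in> {1, 0, -1}}"
  let ?f = "\<lambda>ps. ps @ [(int (Suc n), s)]"
  have "finite ?T" by (rule finite_subset[of _ "{..K}"]) auto
  moreover have "\<forall>t\<in>?T. finite (?f ` bounded_paths K n r t)"
    using assms by (auto simp: finite_bounded_paths)
  moreover have "\<forall>t\<in>?T. \<forall>t'\<in>?T. t \<noteq> t' \<longrightarrow> ?f ` bounded_paths K n r t \<inter> ?f ` bounded_paths K n r t' = {}"
    by (auto simp: bounded_paths_def)
  ultimately have "bounded_moment K b l (Suc n) r s =
    (\<Sum>t\<in>?T. \<Sum>ps\<in>?f ` bounded_paths K n r t. path_weight b l ps)"
    unfolding bounded_moment_def bounded_paths_Suc[OF assms(2)] by (rule sum.UNION_disjoint)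
  also have "\<dots> = (\<Sum>t\<in>?T. \<Sum>ps\<in>bounded_paths K n r t. path_weight b l (?f ps))"
    by (rule sum.cong[OF refl], subst sum.reindex) (auto simp: inj_on_def)
  also have "\<dots> = (\<Sum>t\<in>?T. bounded_moment K b l n r t * step_weight b l (int n, t) (int (Suc n), s))"
    unfolding bounded_moment_def sum_distrib_right
    by (rule sum.cong[OF refl], rule sum.cong[OF refl], subst path_weight_snoc)
      (auto simp: bounded_paths_def motzkin_path_def)
  finally show ?thesis .
qed

lemma bounded_moment_eq_pow:
  assumes "s \<le> K"
  shows "bounded_moment K (\<lambda>_. 0 :: 'a::comm_ring_1) (\<lambda>_. 1) n 0 s =
    (path_mat (\<lambda>_. 0) (Suc K) ^\<^sub>m n) $$ (0, s)"
  using assms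
proof (induction n arbitrary: s)
  case 0
  then show ?case by (simp add: bounded_moment_0 path_mat_def)
next
  case (Suc n)
  let ?m = "bounded_moment K (\<lambda>_. 0 :: 'a) (\<lambda>_. 1) n 0"
  have "finite {t. t \<le> K \<and> int s - int t \<in> {1, 0, -1}}"
    by (rule finite_subset[of _ "{..K}"]) auto
  \<comment> \<open>Horizontal steps have weight 0, so only the two neighbours of \<open>s\<close>
    contribute.\<close>
  then have "bounded_moment K (\<lambda>_. 0 :: 'a) (\<lambda>_. 1) (Suc n) 0 s =
    (\<Sum>t\<in>{t. t \<le> K \<and> (t + 1 = s \<or> t = s + 1)}. ?m t)"
    unfolding bounded_moment_Suc[OF le0 Suc.prems]
    by (intro sum.mono_neutral_cong_right) (auto simp: step_weight_def)
  also have "{t. t \<le> K \<and> (t + 1 = s \<or> t = s + 1)} =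
    (if s = 0 then {} else {s - 1}) \<union> (if s + 1 \<le> K then {s + 1} else {})"
    using Suc.prems by auto
  also have "(\<Sum>t\<in>\<dots>. ?m t) = (if s = 0 then 0 else ?m (s - 1)) + (if s + 1 \<le> K then ?m (s + 1) else 0)"
    by simp
  also have "\<dots> = (path_mat (\<lambda>_. 0) (Suc K) ^\<^sub>m Suc n) $$ (0, s)"
    using Suc by (simp add: mult_path_mat_entry[of _ "Suc K"] del: index_mult_mat(1))
  finally show ?case .
qed

section \<open>Extension to negative lengths\<close>

text \<open>As \<open>c 0\<close> is nonzero, the leftmost term of the recurrence is forced to
  vanish once the others do, so the zeros spread to the left one step at a time.\<close>

lemma two_sided_recurrence_zero:
  fixes u :: "int \<Rightarrow> 'a::idom"
  assumes "\<And>z. 0 \<le> z \<Longrightarrow> u z = 0" and "c 0 \<noteq> 0"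
    and "\<And>z. (\<Sum>i\<le>d. c i * u (z + int i)) = 0"
  shows "u z = 0"
proof -
  have "\<forall>z\<ge>- int n. u z = 0" for n
  proof (induction n)
    case (Suc n)
    have "(\<Sum>i\<le>d. c i * u (- int (Suc n) + int i)) = (\<Sum>i\<le>d. if i = 0 then c 0 * u (- int (Suc n)) else 0)"
      using Suc by (intro sum.cong) auto
    with assms(2,3) have "u (- int (Suc n)) = 0" by simp
    moreover have "z = - int (Suc n) \<or> - int n \<le> z" if "- int (Suc n) \<le> z" for z
      using that by auto
    ultimately show ?case using Suc by auto
  qed (use assms in simp)
  from this[of "nat (- z)"] show ?thesis by simp
qed

text \<open>The two extensions may obey different recurrences \<open>p\<close> and \<open>q\<close>.
  Applying \<open>p\<close> to their difference \<open>h\<close> gives a sequence \<open>u\<close>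
  that vanishes on the nonnegative integers and obeys \<open>q\<close>, so \<open>u\<close> is zero.
  Then \<open>h\<close> obeys \<open>p\<close> and is zero for the same reason.\<close>

lemma extends_by_recurrence_unique:
  assumes "extends_by_recurrence f g" "extends_by_recurrence f g'"
  shows "g = g'"
proof -
  have monic: "\<exists>d c. c 0 \<noteq> 0 \<and> (\<forall>z. (\<Sum>i\<le>d. c i * h (z + int i)) = 0)"
    if ext: "extends_by_recurrence f h" for h
  proof -
    obtain d c where dc: "0 < d" "c 0 \<noteq> 0" "\<forall>n. h (n + int d) = (\<Sum>i<d. c i * h (n + int i))"
      using ext by (auto simp: extends_by_recurrence_def)
    \<comment> \<open>All terms are moved to one side; \<open>0 < d\<close> ensures that the lowest
      coefficient is still \<open>c 0\<close>.\<close>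
    define c' where "c' i = (if i = d then -1 else c i)" for i
    have "(\<Sum>i\<le>d. c' i * h (z + int i)) = (\<Sum>i<d. c i * h (z + int i)) - h (z + int d)" for z
      by (simp add: c'_def flip: lessThan_Suc_atMost)
    with dc show ?thesis by (intro exI[of _ d] exI[of _ c']) (auto simp: c'_def)
  qed
  obtain d p where p: "p 0 \<noteq> 0" "\<And>z. (\<Sum>i\<le>d. p i * g (z + int i)) = 0"
    using monic[OF assms(1)] by auto
  obtain e q where q: "q 0 \<noteq> 0" "\<And>z. (\<Sum>i\<le>e. q i * g' (z + int i)) = 0"
    using monic[OF assms(2)] by auto
  define h where "h z = g z - g' z" for z
  define u where "u z = (\<Sum>i\<le>d. p i * h (z + int i))" for z
  have h0: "h z = 0" if "0 \<le> z" for z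
    using assms that unfolding extends_by_recurrence_def h_def
    by (metis nonneg_int_cases right_minus_eq)
  have u: "u z = - (\<Sum>i\<le>d. p i * g' (z + int i))" for z
    using p(2)[of z] by (simp add: u_def h_def right_diff_distrib sum_subtractf)
  \<comment> \<open>\<open>u\<close> is also a combination of shifts of \<open>g'\<close>, so it inherits the recurrence of \<open>g'\<close>.\<close>
  have "(\<Sum>j\<le>e. q j * u (z + int j)) = 0" for z
  proof -
    have "(\<Sum>j\<le>e. q j * u (z + int j)) =
      - (\<Sum>j\<le>e. \<Sum>i\<le>d. p i * (q j * g' (z + int i + int j)))"
      by (simp add: u sum_distrib_left sum_negf ac_simps)
    also have "\<dots> = - (\<Sum>i\<le>d. p i * (\<Sum>j\<le>e. q j * g' (z + int i + int j)))"
      by (subst sum.swap) (simp add: sum_distrib_left)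
    finally show ?thesis by (simp add: q(2))
  qed
  then have "u z = 0" for z
    by (rule two_sided_recurrence_zero[of u q e, rotated 2]) (simp_all add: u_def h0 q(1))
  then have "(\<Sum>i\<le>d. p i * h (z + int i)) = 0" for z by (simp add: u_def)
  then have "h z = 0" for z
    by (rule two_sided_recurrence_zero[of h p d, rotated 2]) (simp_all add: h0 p(1))
  then show ?thesis by (auto simp: h_def)
qed

text \<open>The coefficients of the Chebyshev polynomials of the second kind in the variable \<open>x / 2\<close>.\<close>

fun chebyshev_coeff :: "nat \<Rightarrow> nat \<Rightarrow> 'a::comm_ring_1" where
  "chebyshev_coeff 0 i = (if i = 0 then 1 else 0)"
| "chebyshev_coeff (Suc 0) i = (if i = 1 then 1 else 0)"
| "chebyshev_coeff (Suc (Suc l)) i =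
    (if i = 0 then 0 else chebyshev_coeff (Suc l) (i - 1)) - chebyshev_coeff l i"

lemma chebyshev_coeff_eq_0: "l < i \<Longrightarrow> chebyshev_coeff l i = 0"
  by (induction l i rule: chebyshev_coeff.induct) auto

lemma chebyshev_coeff_lead: "chebyshev_coeff l l = 1"
  by (induction l rule: induct_nat_012) (auto simp: chebyshev_coeff_eq_0)

lemma chebyshev_coeff_0: "chebyshev_coeff (2 * l) 0 = (- 1) ^ l"
  by (induction l) auto

text \<open>Solved for \<open>R z (l + 1)\<close>, the hypothesis is the three-term recurrence of
  \<open>chebyshev_coeff\<close> with the shift of \<open>z\<close> by 1 in place of the
  variable.\<close>

lemma path_recurrence_solution:
  fixes R :: "int \<Rightarrow> nat \<Rightarrow> 'a::comm_ring_1"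
  assumes R: "\<And>z l. l < d \<Longrightarrow> R (z + 1) l = (if l = 0 then 0 else R z (l - 1)) + R z (l + 1)"
  shows "l \<le> d \<Longrightarrow> R z l = (\<Sum>i\<le>l. chebyshev_coeff l i * R (z + int i) 0)"
proof (induction l arbitrary: z rule: induct_nat_012)
  case 1
  then show ?case using R[of 0 z] by simp
next
  case (ge2 l)
  have "(\<Sum>i\<le>Suc (Suc l). chebyshev_coeff (Suc (Suc l)) i * R (z + int i) 0) =
    (\<Sum>i\<le>Suc (Suc l). (if i = 0 then 0 else chebyshev_coeff (Suc l) (i - 1)) * R (z + int i) 0) -
    (\<Sum>i\<le>Suc (Suc l). chebyshev_coeff l i * R (z + int i) 0)"
    by (simp only: chebyshev_coeff.simps left_diff_distrib sum_subtractf)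
  also have "(\<Sum>i\<le>Suc (Suc l). chebyshev_coeff l i * R (z + int i) 0) = R z l"
    using ge2 by (simp add: chebyshev_coeff_eq_0)
  also have "(\<Sum>i\<le>Suc (Suc l). (if i = 0 then 0 else chebyshev_coeff (Suc l) (i - 1)) * R (z + int i) 0) =
    (\<Sum>i\<le>Suc l. chebyshev_coeff (Suc l) i * R (z + 1 + int i) 0)"
    by (subst sum.atMost_Suc_shift) (simp add: ac_simps)
  also have "\<dots> = R (z + 1) (Suc l)" using ge2 by simp
  also have "R (z + 1) (Suc l) - R z l = R z (Suc (Suc l))" using R[of "Suc l" z] ge2.prems by simp
  finally show ?case by simp
qed simp

text \<open>For negative \<open>z\<close> the moment is a definite description, so the matrix
  entries must be shown to be an extension by recurrence; uniqueness then identifies them. The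
  coefficients come from \<open>chebyshev_coeff (2 * n)\<close>, whose lowest one is a sign because
  the degree is even.\<close>

lemma mu_eq_zpow:
  fixes A A' :: "'a::field mat"
  assumes "0 < n" and A: "A = path_mat (\<lambda>_. 0) (2 * n)" and pair: "inverse_pair (2 * n) A A'"
    and s: "s < 2 * n"
  shows "mu (2 * n - 1) (\<lambda>_. 0) (\<lambda>_. 1) z 0 s = zpow A A' z $$ (0, s)"
proof -
  interpret inverse_pair "2 * n" A A' by fact
  define d where "d = 2 * n"
  define f where "f m = bounded_moment (d - 1) (\<lambda>_. 0 :: 'a) (\<lambda>_. 1) m 0 s" for m
  \<comment> \<open>The value 0 at \<open>l = d\<close> encodes the end of the path: the recurrence
    needs no special case at the last vertex.\<close>
  define R where "R z l = (if l < d then zpow A A' z $$ (0, l) else 0)" for z l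
  have "0 < d" using \<open>0 < n\<close> by (simp add: d_def)
  have "f m = zpow A A' (int m) $$ (0, s)" for m
    using bounded_moment_eq_pow[of s "d - 1" m, where ?'a = 'a] s \<open>0 < d\<close>
    by (simp add: f_def d_def flip: A)
  moreover have R_Suc: "R (z + 1) l = (if l = 0 then 0 else R z (l - 1)) + R z (l + 1)" if "l < d" for z l
  proof -
    have "R (z + 1) l = (zpow A A' z * A) $$ (0, l)" using that by (simp add: R_def zpow_plus_1)
    also have "\<dots> = 0 * zpow A A' z $$ (0, l) + (if l = 0 then 0 else zpow A A' z $$ (0, l - 1))
        + (if l + 1 < 2 * n then zpow A A' z $$ (0, l + 1) else 0)"
      using zpow_carrier[of z] that \<open>0 < n\<close> unfolding A d_def
      by (intro mult_path_mat_entry[of _ "2 * n"]) simp_all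
    finally show ?thesis using that by (auto simp: R_def d_def)
  qed
  have sol: "R z l = (\<Sum>i\<le>l. chebyshev_coeff l i * R (z + int i) 0)" if "l \<le> d" for z l
    by (rule path_recurrence_solution[where d = d and R = R, OF _ that]) (rule R_Suc)
  \<comment> \<open>For column 0 this is \<open>R z d = 0\<close> written out by \<open>sol\<close>.
    Column \<open>s\<close> is a fixed combination of shifts of column 0 and inherits the
    relation.\<close>
  have row: "(\<Sum>i\<le>d. chebyshev_coeff d i * R (z + int i) s) = 0" for z
  proof -
    have "(\<Sum>i\<le>d. chebyshev_coeff d i * R (z + int i) s) =
      (\<Sum>i\<le>d. \<Sum>j\<le>s. chebyshev_coeff s j * (chebyshev_coeff d i * R (z + int j + int i) 0))"
    proof (rule sum.cong[OF refl])
      fix i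
      have "R (z + int i) s = (\<Sum>j\<le>s. chebyshev_coeff s j * R (z + int j + int i) 0)"
        using sol[of s "z + int i"] s by (simp add: d_def add.assoc add.commute[of "int i"])
      then show "chebyshev_coeff d i * R (z + int i) s =
        (\<Sum>j\<le>s. chebyshev_coeff s j * (chebyshev_coeff d i * R (z + int j + int i) 0))"
        by (simp add: sum_distrib_left mult.left_commute)
    qed
    also have "\<dots> = (\<Sum>j\<le>s. chebyshev_coeff s j * R (z + int j) d)"
      by (subst sum.swap) (simp add: sol[of d] sum_distrib_left)
    finally show ?thesis by (simp add: R_def)
  qed
  have "R (z + int d) s = (\<Sum>i<d. - chebyshev_coeff d i * R (z + int i) s)" for z
    using row[of z] by (simp add: chebyshev_coeff_lead sum_negf add_eq_0_iff flip: lessThan_Suc_atMost)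
  moreover have "- chebyshev_coeff d 0 \<noteq> (0 :: 'a)" by (simp add: d_def chebyshev_coeff_0)
  ultimately have ext: "extends_by_recurrence f (\<lambda>z. R z s)"
    unfolding extends_by_recurrence_def using s \<open>0 < d\<close>
    by (auto simp: R_def d_def intro!: exI[of _ d] exI[of _ "\<lambda>i. - chebyshev_coeff d i"])
  have "(THE g. extends_by_recurrence f g) = (\<lambda>z. R z s)"
    by (rule the_equality) (use ext extends_by_recurrence_unique in auto)
  moreover have "f (nat z) = R z s" if "0 \<le> z"
    using ext that unfolding extends_by_recurrence_def by (metis int_nat_eq)
  ultimately show ?thesis
    using s by (simp add: mu_def R_def d_def f_def[abs_def])
qed

section \<open>Duality of the two Hankel determinants\<close>

lemma choose_2_add: "(k + m) choose 2 = (k choose 2) + (m choose 2) + k * m"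
  by (induction k) (simp_all add: numeral_2_eq_2)

theorem theorem1p4:
  fixes n k m :: nat
  shows "det (mat k k (\<lambda>(i, j).
            \<Sum>s = 0..2 * k + 2 * m - 1.
              mu (2 * k + 2 * m - 1) (\<lambda>_. 0 :: rat) (\<lambda>_. 1)
                (int n + int i + int j + 2 * int m - 1) 0 s)) =
         (- 1) ^ (((k choose 2) + (m choose 2)) * (n + 1)) *
         det (mat m m (\<lambda>(i, j). of_nat (card (alt_seqs (k + m) (n + i + j)))))"
proof (cases "k + m = 0")
  case True
  \<comment> \<open>Here \<open>2 * k + 2 * m - 1\<close> is truncated to 0, but both matrices have
    size 0.\<close>
  then show ?thesis by simp
next
  case False
  define N where "N = k + m"
  have "0 < N" and NK: "2 * k + 2 * m = 2 * N" using False by (auto simp: N_def)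
  define A :: "rat mat" where "A = path_mat (\<lambda>_. 0) (2 * N)"
  define C :: "rat mat" where "C = path_mat loop N"
  define \<delta> :: rat where "\<delta> = (- 1) ^ (N choose 2)"
  have "A \<in> carrier_mat (2 * N) (2 * N)" "det A \<noteq> 0"
    by (simp_all add: A_def det_path_mat_zero_diagonal)
  then obtain A' where pairA: "inverse_pair (2 * N) A A'"
    using inverse_pair_exists by blast
  have C: "C \<in> carrier_mat N N" and detC: "det C = \<delta>"
    by (simp_all add: C_def det_path_mat_loop \<delta>_def)
  then have "det C \<noteq> 0" by (simp add: \<delta>_def)
  then obtain C' where pairC: "inverse_pair N C C'"
    using inverse_pair_exists[OF C] by blast
  interpret inverse_pair N C C' by fact
  \<comment> \<open>For \<open>n = m = 0\<close> this is -1, so integer powers are needed on the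
    left side too.\<close>
  define p where "p = int n + 2 * int m - 1"
  define P where "P = zpow C C' p"
  define Q where "Q = zpow C C' (- p)"
  have P: "P \<in> carrier_mat N N" and Q: "Q \<in> carrier_mat N N" by (simp_all add: P_def Q_def)
  have PQ: "P * Q = 1\<^sub>m N" using zpow_add[of p "- p"] by (simp add: P_def Q_def)

  have moment: "(\<Sum>s = 0..2 * k + 2 * m - 1. mu (2 * k + 2 * m - 1) (\<lambda>_. 0 :: rat) (\<lambda>_. 1) z 0 s) =
    zpow C C' z $$ (0, 0)" for z
  proof -
    have "{0..2 * N - 1} = {..<2 * N}" using \<open>0 < N\<close> by auto
    moreover have "(\<Sum>s<2 * N. mu (2 * N - 1) (\<lambda>_. 0 :: rat) (\<lambda>_. 1) z 0 s) =
        (\<Sum>s<2 * N. zpow A A' z $$ (0, s))"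
      by (intro sum.cong refl mu_eq_zpow[OF \<open>0 < N\<close> A_def pairA]) simp
    ultimately show ?thesis
      by (simp only: NK sum_bottom_row_zpow[OF \<open>0 < N\<close> A_def pairA C_def pairC])
  qed
  have "det (mat k k (\<lambda>(i, j). zpow C C' (int n + int i + int j + 2 * int m - 1) $$ (0, 0))) =
    det (mat k k (\<lambda>(i, j). (C ^\<^sub>m i * P * C ^\<^sub>m j) $$ (0, 0)))"
  proof -
    have "zpow C C' (int n + int i + int j + 2 * int m - 1) = C ^\<^sub>m i * P * C ^\<^sub>m j" for i j
    proof -
      have "int n + int i + int j + 2 * int m - 1 = int i + p + int j" by (simp add: p_def)
      then show ?thesis by (simp only: zpow_add zpow_of_nat P_def)
    qed
    then show ?thesis by simp
  qed
  also have "\<dots> = det (mat k k (\<lambda>(i, j). P $$ (i, j)))"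
    using P unfolding C_def by (rule det_krylov) (simp add: N_def)
  also have "\<dots> = det P * det (mat m m (\<lambda>(i, j). Q $$ (k + i, k + j)))"
    using P Q PQ unfolding N_def by (rule jacobi_complementary_minor)
  \<comment> \<open>As \<open>p\<close> may be -1, the determinant is read off from
    \<open>P * C\<close>, which is the natural power \<open>n + 2 * m\<close> of
    \<open>C\<close>.\<close>
  also have "det P = \<delta> ^ (n + 1)"
  proof -
    have "zpow C C' (p + 1) = C ^\<^sub>m (n + 2 * m)"
      using zpow_of_nat[of "n + 2 * m"] by (simp add: p_def)
    then have "det P * \<delta> = \<delta> ^ (n + 2 * m)"
      using zpow_plus_1[of p] det_mult[OF P C] det_pow_mat[OF C, of "n + 2 * m"]
      by (simp add: P_def detC)
    moreover have "\<delta> * \<delta> = 1" by (simp add: \<delta>_def flip: power_add)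
    ultimately have "det P = \<delta> ^ (n + 2 * m) * \<delta>" by (metis mult.assoc mult.right_neutral)
    then show ?thesis using \<open>\<delta> * \<delta> = 1\<close> by (simp add: power_add power_mult power2_eq_square)
  qed
  also have "det (mat m m (\<lambda>(i, j). Q $$ (k + i, k + j))) =
    (- 1) ^ ((N + 1) * (n + 1) * m) * det (mat m m (\<lambda>(i, j). of_nat (card (alt_seqs (k + m) (n + i + j)))))"
  proof -
    define f where "f i j = (of_nat (card (alt_seqs N (n + i + j))) :: rat)" for i j
    define e :: rat where "e = (- 1) ^ (N + 1)"
    \<comment> \<open>The complementary minor sits at the last \<open>m\<close> vertices. After
      reversal it is a leading minor, and \<open>det_krylov\<close> applies to the reversed path
      \<open>Cr\<close>.\<close>
    define Cr where "Cr = rev_mat C"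
    have Cr: "Cr = path_mat (\<lambda>i. loop (N - 1 - i)) N"
    proof (rule eq_matI)
      fix i j
      assume "i < dim_row (path_mat (\<lambda>i. loop (N - 1 - i) :: rat) N)"
        and "j < dim_col (path_mat (\<lambda>i. loop (N - 1 - i) :: rat) N)"
      then have ij: "i < N" "j < N" by (simp_all add: path_mat_def)
      then have "N - 1 - i = N - 1 - j \<longleftrightarrow> i = j" "N - 1 - i = N - 1 - j + 1 \<longleftrightarrow> j = i + 1"
        "N - 1 - j = N - 1 - i + 1 \<longleftrightarrow> i = j + 1" by linarith+
      with ij show "Cr $$ (i, j) = path_mat (\<lambda>i. loop (N - 1 - i)) N $$ (i, j)"
        by (simp add: Cr_def C_def rev_mat_def path_mat_def disj_commute)
    qed (simp_all add: Cr_def C_def rev_mat_def path_mat_def)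
    have entry: "(Cr ^\<^sub>m i * rev_mat Q * Cr ^\<^sub>m j) $$ (0, 0) =
      e ^ (n + 1 + (m - 1 - i) + (m - 1 - j)) * f (m - 1 - i) (m - 1 - j)" if "i < m" "j < m" for i j
    proof -
      \<comment> \<open>The exponent \<open>i + j - p\<close> equals \<open>- ?l - 1\<close>:
        lengths decrease as \<open>i\<close> and \<open>j\<close> grow, which a later reversal of
        the matrix corrects.\<close>
      let ?l = "n + (m - 1 - i) + (m - 1 - j)"
      have "Cr ^\<^sub>m i * rev_mat Q * Cr ^\<^sub>m j = rev_mat (C ^\<^sub>m i * Q * C ^\<^sub>m j)"
        using C Q mult_carrier_mat[of "C ^\<^sub>m i" N N Q N]
        by (simp add: Cr_def rev_mat_pow[of _ N] rev_mat_mult[of _ N])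
      also have "C ^\<^sub>m i * Q * C ^\<^sub>m j = zpow C C' (int i + - p + int j)"
        by (simp only: zpow_add zpow_of_nat Q_def)
      also have "int i + - p + int j = - int ?l - 1"
        using that by (simp add: p_def of_nat_diff)
      also have "rev_mat (zpow C C' (- int ?l - 1)) $$ (0, 0) = zpow C C' (- int ?l - 1) $$ (N - 1, N - 1)"
        using \<open>0 < N\<close> carrier_matD[OF zpow_carrier[of "- int ?l - 1"]] by (simp add: rev_mat_def)
      also have "\<dots> = (- 1) ^ ((N + 1) * (?l + 1)) * of_nat (alt_count N ?l 0)"
        using \<open>0 < N\<close> C_def pairC by (rule zpow_loop_corner)
      also have "(- 1 :: rat) ^ ((N + 1) * (?l + 1)) = e ^ (?l + 1)"
        by (simp only: e_def power_mult)
      finally show ?thesis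
        using \<open>0 < N\<close> by (simp add: f_def card_alt_seqs ac_simps)
    qed
    have "det (mat m m (\<lambda>(i, j). Q $$ (k + i, k + j))) =
      det (mat m m (\<lambda>(i, j). Q $$ (k + (m - 1 - i), k + (m - 1 - j))))"
      by (rule det_reverse[of m "\<lambda>i j. Q $$ (k + i, k + j)", symmetric])
    also have "mat m m (\<lambda>(i, j). Q $$ (k + (m - 1 - i), k + (m - 1 - j))) =
      mat m m (\<lambda>(i, j). rev_mat Q $$ (i, j))"
      using Q by (intro eq_matI) (auto simp: rev_mat_def N_def)
    also have "det \<dots> = det (mat m m (\<lambda>(i, j). (Cr ^\<^sub>m i * rev_mat Q * Cr ^\<^sub>m j) $$ (0, 0)))"
      unfolding Cr using Q by (intro det_krylov[symmetric]) (simp_all add: N_def)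
    also have "mat m m (\<lambda>(i, j). (Cr ^\<^sub>m i * rev_mat Q * Cr ^\<^sub>m j) $$ (0, 0)) =
      mat m m (\<lambda>(i, j). e ^ (n + 1 + (m - 1 - i) + (m - 1 - j)) * f (m - 1 - i) (m - 1 - j))"
      by (rule cong_mat[OF refl refl]) (simp only: prod.case entry)
    also have "det \<dots> = det (mat m m (\<lambda>(i, j). e ^ (n + 1 + i + j) * f i j))"
      by (rule det_reverse[of m "\<lambda>i j. e ^ (n + 1 + i + j) * f i j"])
    also have "\<dots> = e ^ ((n + 1) * m) * det (mat m m (\<lambda>(i, j). f i j))"
      by (rule det_scale_signs) (simp add: e_def flip: power_add)
    also have "e ^ ((n + 1) * m) = (- 1) ^ ((N + 1) * (n + 1) * m)"
      by (simp only: e_def power_mult)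
    finally show ?thesis by (simp only: f_def N_def)
  qed
  finally have main: "det (mat k k (\<lambda>(i, j). zpow C C' (int n + int i + int j + 2 * int m - 1) $$ (0, 0))) =
    \<delta> ^ (n + 1) * ((- 1) ^ ((N + 1) * (n + 1) * m) *
      det (mat m m (\<lambda>(i, j). of_nat (card (alt_seqs (k + m) (n + i + j))))))" .
  have "\<delta> ^ (n + 1) * (- 1) ^ ((N + 1) * (n + 1) * m) = (- 1) ^ (((k choose 2) + (m choose 2)) * (n + 1))"
  proof -
    \<comment> \<open>By \<open>choose_2_add\<close> the two numbers differ by
      \<open>2 * k * m + m * (m + 1)\<close>, which is even.\<close>
    have "even ((N choose 2) + (N + 1) * m) \<longleftrightarrow> even ((k choose 2) + (m choose 2))"
      by (auto simp: N_def choose_2_add)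
    then have "even (((N choose 2) + (N + 1) * m) * (n + 1)) \<longleftrightarrow>
        even (((k choose 2) + (m choose 2)) * (n + 1))" by simp
    moreover have "\<delta> ^ (n + 1) * (- 1) ^ ((N + 1) * (n + 1) * m) =
        (- 1) ^ (((N choose 2) + (N + 1) * m) * (n + 1))"
      unfolding \<delta>_def power_mult[symmetric] power_add[symmetric]
      by (rule arg_cong[of _ _ "power (- 1)"]) (simp add: algebra_simps)
    ultimately show ?thesis by (simp only: minus_one_power_iff)
  qed
  with main show ?thesis unfolding moment by (simp add: mult.assoc[symmetric])
qed

end
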